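(* Let $(X_i,A_i,F_i,P_i)_{i\in N}$ be a generalized abstract economy. Assume that, for each $i\in N$, the following conditions are fulfilled: a) $X_i$ is a nonempty, convex and compact set in a Hausdorff locally convex space $E_i$; b) $A_i,F_i$ have nonempty, convex values and open lower sections; c) the set $\{(x_i,y_i)\in X_i\times X_i: A_i(x_{-i})\cap P_i(x,y)=\emptyset\}\cap(A_i(x_{-i})\times F_i(y_{-i}))$ is nonempty for each $(x_{-i},y_{-i})\in X_{-i}\times X_{-i}$; d) $\{(x_i,y_i)\in X_i\times X_i: A_i(x_{-i})\cap P_i(x,y)=\emptyset\}$ is convex for each $(x_{-i},y_{-i})\in X_{-i}\times X_{-i}$; e) $\{(x_{-i},y_{-i})\in X_{-i}\times X_{-i}: A_i(x_{-i})\cap P_i(x,y)=\emptyset\}$ is open for each $(x_i,y_i)\in X_i\times X_i$. Then there exists a pair $(x^*,y^* )\in X\times X$ such that $x_i^*\in A_i(x^*_{-i})$, $y_i^*\in F_i(y^*_{-i})$ and $A_i(x^*_{-i})\cap P_i(x^*,y^* )=\emptyset$ for each $i\in N$.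
   Context: $N=\{1,\dots,n\}$ is a finite set of agents, $X=\prod_{i\in N}X_i$, $X_{-i}=\prod_{j\neq i}X_j$, and for $x\in X$, $x_{-i}=(x_1,\dots,x_{i-1},x_{i+1},\dots,x_n)$; one writes $x=(x_{-i},x_i)$, $y=(y_{-i},y_i)$. A correspondence is a set-valued map (values may be empty unless stated otherwise). A generalized abstract economy is a family $(X_i,A_i,F_i,P_i)_{i\in N}$ where, for each $i\in N$, $X_i$ is the strategy set, $P_i:X\times X\to 2^{X_i}$ is a preference correspondence and $A_i,F_i:X_{-i}\to 2^{X_i}$ are constraint correspondences. A correspondence $T:U\to 2^V$ between topological spaces has open lower sections if $T^{-1}(v)=\{u\in U: v\in T(u)\}$ is open in $U$ for each $v\in V$. *)

theory Defs
  imports "HOL-Analysis.Analysis"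
begin

text \<open>
  A real topological vector space is given by a topology whose carrier is a linear subspace of an
  ambient real vector space. The ambient space carries no topology, so several carriers inside it,
  each with its own topology, represent an arbitrary family of spaces: embed each member in the
  direct product of the family.
\<close>

definition topological_vector_space_on :: "'e::real_vector topology \<Rightarrow> bool" where
  "topological_vector_space_on E \<longleftrightarrow>
     subspace (topspace E) \<and>
     continuous_map (prod_topology E E) E (\<lambda>(x, y). x + y) \<and>
     continuous_map (prod_topology euclideanreal E) E (\<lambda>(c, x). c *\<^sub>R x)"

definition locally_convex_space_on :: "'e::real_vector topology \<Rightarrow> bool" where
  "locally_convex_space_on E \<longleftrightarrow>
     topological_vector_space_on E \<and>
     (\<forall>U. openin E U \<and> 0 \<in> U \<longrightarrow> (\<exists>V. openin E V \<and> convex V \<and> 0 \<in> V \<and> V \<subseteq> U))"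

definition correspondence :: "'u set \<Rightarrow> 'v set \<Rightarrow> ('u \<Rightarrow> 'v set) \<Rightarrow> bool" where
  "correspondence U V T \<longleftrightarrow> (\<forall>u\<in>U. T u \<subseteq> V)"

definition open_lower_sections :: "'u topology \<Rightarrow> 'v set \<Rightarrow> ('u \<Rightarrow> 'v set) \<Rightarrow> bool" where
  "open_lower_sections U V T \<longleftrightarrow> (\<forall>v\<in>V. openin U {u \<in> topspace U. v \<in> T u})"

definition profiles :: "nat \<Rightarrow> (nat \<Rightarrow> 'e set) \<Rightarrow> (nat \<Rightarrow> 'e) set" where
  "profiles n X = (\<Pi>\<^sub>E i\<in>{1..n}. X i)"

definition profiles_except :: "nat \<Rightarrow> (nat \<Rightarrow> 'e set) \<Rightarrow> nat \<Rightarrow> (nat \<Rightarrow> 'e) set" where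
  "profiles_except n X i = (\<Pi>\<^sub>E j\<in>{1..n} - {i}. X j)"

definition except :: "nat \<Rightarrow> nat \<Rightarrow> (nat \<Rightarrow> 'e) \<Rightarrow> nat \<Rightarrow> 'e" where
  "except n i x = restrict x ({1..n} - {i})"

text \<open>
  Conversely, for \<open>u\<close> in \<open>profiles_except n X i\<close> and \<open>a\<close> in \<open>X i\<close>, the profile
  $(u, a)$ with $i$-th entry $a$ is the function update \<open>u(i := a)\<close>.
\<close>

definition profiles_except_topology ::
    "nat \<Rightarrow> (nat \<Rightarrow> 'e topology) \<Rightarrow> (nat \<Rightarrow> 'e set) \<Rightarrow> nat \<Rightarrow> (nat \<Rightarrow> 'e) topology" where
  "profiles_except_topology n E X i =
     product_topology (\<lambda>j. subtopology (E j) (X j)) ({1..n} - {i})"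

definition generalized_abstract_economy ::
    "nat \<Rightarrow> (nat \<Rightarrow> 'e set) \<Rightarrow> (nat \<Rightarrow> (nat \<Rightarrow> 'e) \<Rightarrow> 'e set) \<Rightarrow> (nat \<Rightarrow> (nat \<Rightarrow> 'e) \<Rightarrow> 'e set) \<Rightarrow>
     (nat \<Rightarrow> (nat \<Rightarrow> 'e) \<times> (nat \<Rightarrow> 'e) \<Rightarrow> 'e set) \<Rightarrow> bool" where
  "generalized_abstract_economy n X A F P \<longleftrightarrow>
     (\<forall>i\<in>{1..n}.
        correspondence (profiles_except n X i) (X i) (A i) \<and>
        correspondence (profiles_except n X i) (X i) (F i) \<and>
        correspondence (profiles n X \<times> profiles n X) (X i) (P i))"

end

theory Submission
  imports Defs "HOL-Homology.Simplices"
begin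

text \<open>
  The conclusion asks for a fixed point. For profiles \<open>x\<close> and \<open>y\<close> let \<open>T (x, y)\<close> consist of the pairs
  \<open>(x', y')\<close> of profiles such that, for every player \<open>i\<close>, the strategies \<open>x' i\<close> and \<open>y' i\<close> satisfy the
  three requirements on player \<open>i\<close> when all the other players keep to \<open>x\<close> and \<open>y\<close>. A pair
  \<open>(x, y) \<in> T (x, y)\<close> is exactly an equilibrium.

  This \<open>T\<close> maps a compact product to its subsets, and it inherits from the hypotheses everything
  that Browder's fixed point theorem needs. Its values are products over the players of sets that are
  nonempty by \<open>c\<close> and convex by \<open>b\<close> and \<open>d\<close>. Its lower sections are finite intersections, one set
  for each player, of sets that are open by \<open>b\<close> and \<open>e\<close>.

  Browder's theorem (\<open>fixed_point_of_open_lower_sections\<close>) reduces to finite dimension. Finitely many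
  lower sections cover the compact space, and the convex combinations of the finitely many points
  that index them are parametrised continuously by a standard simplex. Pulling the cover back to
  the simplex leaves a statement about open covers of a simplex (\<open>standard_simplex_open_cover\<close>), which
  follows from Brouwer's theorem. Brouwer's theorem is needed for simplices whose dimension is not
  known beforehand, hence in \<^typ>\<open>nat \<Rightarrow> real\<close> (\<open>brouwer_standard_simplex\<close>); it is
  derived from Kuhn's combinatorial lemma.
\<close>

section \<open>Brouwer's theorem in arbitrary finite dimension\<close>

text \<open>
  Cubes of every dimension live in the one type \<^typ>\<open>nat \<Rightarrow> real\<close>, padded with zeros. The
  dimension can then be a number found in the course of a proof, here the size of a finite subcover.
\<close>

definition unit_cube :: "nat \<Rightarrow> (nat \<Rightarrow> real) set" where
  "unit_cube N = {x. (\<forall>i. 0 \<le> x i \<and> x i \<le> 1) \<and> (\<forall>i\<ge>N. x i = 0)}"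

lemma tendsto_coordinatewise:
  fixes f :: "'b \<Rightarrow> 'a \<Rightarrow> 'c::topological_space"
  shows "(f \<longlongrightarrow> l) G \<longleftrightarrow> (\<forall>i. ((\<lambda>k. f k i) \<longlongrightarrow> l i) G)"
  using limitin_componentwise[of "\<lambda>_. euclidean" UNIV f l G]
  by (simp add: euclidean_product_topology)

lemma compact_unit_cube: "compact (unit_cube N)"
proof -
  have coord: "x i \<in> (if i < N then {0..1} else {0}) \<longleftrightarrow> (0 \<le> x i \<and> x i \<le> 1) \<and> (N \<le> i \<longrightarrow> x i = 0)"
    for x :: "nat \<Rightarrow> real" and i
    by (cases "i < N") auto
  have "unit_cube N = PiE UNIV (\<lambda>i. if i < N then {0..1} else {0})"
    by (simp add: unit_cube_def PiE_UNIV_domain Pi_def coord all_conj_distrib del: if_split)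
  moreover have "compactin (powertop_real UNIV) (PiE UNIV (\<lambda>i::nat. if i < N then {0..1} else {0}))"
    by (simp add: compactin_PiE)
  ultimately show ?thesis
    by (simp add: euclidean_product_topology)
qed

text \<open>
  Kuhn's lemma on the grid of mesh \<open>1 / p\<close>. A grid point is labelled in coordinate \<open>i\<close> by whether \<open>f\<close>
  moves it up or down in that direction. On the two opposite faces the label is forced, and it is
  true to the displacement there because \<open>f\<close> cannot leave the cube. A cell that shows both
  labels in every coordinate has \<open>z\<close> as its lower corner.
\<close>

lemma grid_sign_change:
  fixes f :: "(nat \<Rightarrow> real) \<Rightarrow> nat \<Rightarrow> real" and p :: nat
  assumes f: "f \<in> unit_cube N \<rightarrow> unit_cube N" and "0 < p"
  obtains z where "z \<in> unit_cube N"
    and "\<And>i. i < N \<Longrightarrow> \<exists>a\<in>unit_cube N. \<exists>b\<in>unit_cube N.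
           (\<forall>j. \<bar>a j - z j\<bar> \<le> 1 / p \<and> \<bar>b j - z j\<bar> \<le> 1 / p) \<and> a i \<le> f a i \<and> f b i \<le> b i"
proof -
  define pt where "pt r = (\<lambda>i. if i < N then real (r i) / p else 0)" for r :: "nat \<Rightarrow> nat"
  define label :: "(nat \<Rightarrow> nat) \<Rightarrow> nat \<Rightarrow> nat" where
    "label r i = (if r i = 0 then 0 else if r i = p then 1
                  else if pt r i \<le> f (pt r) i then 0 else 1)" for r i
  have pt_cube: "pt r \<in> unit_cube N" if "\<forall>j<N. r j \<le> p" for r
    using that \<open>0 < p\<close> by (auto simp: unit_cube_def pt_def)
  have label: "if label r i = 0 then pt r i \<le> f (pt r) i else f (pt r) i \<le> pt r i"
    if r: "\<forall>j<N. r j \<le> p" and "i < N" for r i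
  proof -
    have "f (pt r) \<in> unit_cube N"
      using f pt_cube[OF r] by auto
    then have "0 \<le> f (pt r) i" "f (pt r) i \<le> 1"
      by (auto simp: unit_cube_def)
    then show ?thesis
      using \<open>i < N\<close> \<open>0 < p\<close> by (auto simp: label_def pt_def)
  qed
  obtain q where q: "\<forall>i<N. q i < p"
    and cell: "\<forall>i<N. \<exists>r s. (\<forall>j<N. q j \<le> r j \<and> r j \<le> q j + 1) \<and>
                 (\<forall>j<N. q j \<le> s j \<and> s j \<le> q j + 1) \<and> label r i \<noteq> label s i"
    by (rule kuhn_lemma[of p N label]) (use \<open>0 < p\<close> in \<open>auto simp: label_def\<close>)
  show thesis
  proof
    show "pt q \<in> unit_cube N"
      using q by (intro pt_cube) (simp add: less_imp_le)
    fix i assume i: "i < N"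
    have bound: "\<forall>j<N. r j \<le> p" if "\<forall>j<N. q j \<le> r j \<and> r j \<le> q j + 1" for r
      using q that by (metis Suc_eq_plus1 Suc_leI order_trans)
    have near: "\<bar>pt r j - pt q j\<bar> \<le> 1 / p" if "\<forall>j<N. q j \<le> r j \<and> r j \<le> q j + 1" for r j
    proof (cases "j < N")
      case True
      then have "\<bar>real (r j) - real (q j)\<bar> \<le> 1"
        using that[rule_format, OF True] by linarith
      then have "\<bar>real (r j) - real (q j)\<bar> / p \<le> 1 / p"
        by (intro divide_right_mono) auto
      then show ?thesis
        using True by (simp add: pt_def flip: diff_divide_distrib)
    qed (simp add: pt_def)
    have witness: "\<exists>a\<in>unit_cube N. \<exists>b\<in>unit_cube N.
        (\<forall>j. \<bar>a j - pt q j\<bar> \<le> 1 / p \<and> \<bar>b j - pt q j\<bar> \<le> 1 / p) \<and> a i \<le> f a i \<and> f b i \<le> b i"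
      if r: "\<forall>j<N. q j \<le> r j \<and> r j \<le> q j + 1" and s: "\<forall>j<N. q j \<le> s j \<and> s j \<le> q j + 1"
        and "label r i = 0" "label s i \<noteq> 0" for r s
    proof (intro bexI conjI allI)
      show "pt r i \<le> f (pt r) i" "f (pt s) i \<le> pt s i"
        using label[OF bound[OF r] i] label[OF bound[OF s] i] \<open>label r i = 0\<close> \<open>label s i \<noteq> 0\<close>
        by simp_all
    qed (rule near[OF r] near[OF s] pt_cube[OF bound[OF r]] pt_cube[OF bound[OF s]])+
    obtain r s where rs: "\<forall>j<N. q j \<le> r j \<and> r j \<le> q j + 1" "\<forall>j<N. q j \<le> s j \<and> s j \<le> q j + 1"
      and "label r i \<noteq> label s i"
      using cell i by blast
    then consider "label r i = 0" "label s i \<noteq> 0" | "label s i = 0" "label r i \<noteq> 0"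
      by (fastforce simp: label_def split: if_splits)
    then show "\<exists>a\<in>unit_cube N. \<exists>b\<in>unit_cube N.
        (\<forall>j. \<bar>a j - pt q j\<bar> \<le> 1 / p \<and> \<bar>b j - pt q j\<bar> \<le> 1 / p) \<and> a i \<le> f a i \<and> f b i \<le> b i"
      by cases (auto intro: witness[OF rs] witness[OF rs(2,1)])
  qed
qed

text \<open>
  As the mesh shrinks, a subsequence of the cells closes in on a point \<open>x\<close>. Coordinate \<open>i\<close> of the
  displacement is nonnegative at one point of each cell and nonpositive at another, so it vanishes
  at \<open>x\<close>.
\<close>

lemma brouwer_unit_cube:
  fixes f :: "(nat \<Rightarrow> real) \<Rightarrow> nat \<Rightarrow> real"
  assumes f: "f \<in> unit_cube N \<rightarrow> unit_cube N" and cont: "continuous_on (unit_cube N) f"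
  obtains x where "x \<in> unit_cube N" "f x = x"
proof -
  have "\<exists>z. z \<in> unit_cube N \<and> (\<forall>i<N. \<exists>a\<in>unit_cube N. \<exists>b\<in>unit_cube N.
           (\<forall>j. \<bar>a j - z j\<bar> \<le> 1 / Suc k \<and> \<bar>b j - z j\<bar> \<le> 1 / Suc k) \<and> a i \<le> f a i \<and> f b i \<le> b i)"
    for k
    by (rule grid_sign_change[OF f zero_less_Suc[of k]]) blast
  then obtain z where zC: "\<And>k. z k \<in> unit_cube N"
    and z: "\<And>k i. i < N \<Longrightarrow> \<exists>a\<in>unit_cube N. \<exists>b\<in>unit_cube N.
           (\<forall>j. \<bar>a j - z k j\<bar> \<le> 1 / Suc k \<and> \<bar>b j - z k j\<bar> \<le> 1 / Suc k) \<and> a i \<le> f a i \<and> f b i \<le> b i"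
    by metis
  obtain x \<sigma> where x: "x \<in> unit_cube N" and \<sigma>: "strict_mono (\<sigma> :: nat \<Rightarrow> nat)"
    and lim: "(z \<circ> \<sigma>) \<longlonglongrightarrow> x"
    using compact_unit_cube[of N, unfolded compact_def] zC by meson
  have mesh: "(\<lambda>k. 1 / real (Suc (\<sigma> k))) \<longlonglongrightarrow> 0"
    using LIMSEQ_subseq_LIMSEQ[OF LIMSEQ_inverse_real_of_nat \<sigma>] by (simp add: o_def inverse_eq_divide)
  have near_lim: "(\<lambda>k. f (a k) i - a k i) \<longlonglongrightarrow> f x i - x i"
    if aC: "\<And>k. a k \<in> unit_cube N" and a: "\<And>k j. \<bar>a k j - z (\<sigma> k) j\<bar> \<le> 1 / Suc (\<sigma> k)" for a i
  proof -
    have "(\<lambda>k. a k j) \<longlonglongrightarrow> x j" for j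
    proof -
      have "(\<lambda>k. a k j - z (\<sigma> k) j) \<longlonglongrightarrow> 0"
        by (rule Lim_null_comparison[OF _ mesh]) (use a in auto)
      moreover have "(\<lambda>k. z (\<sigma> k) j) \<longlonglongrightarrow> x j"
        using lim by (simp add: tendsto_coordinatewise[of _ x] o_def)
      ultimately show ?thesis
        using tendsto_add by fastforce
    qed
    then have "a \<longlonglongrightarrow> x"
      by (simp add: tendsto_coordinatewise[of a])
    moreover from this have "(\<lambda>k. f (a k)) \<longlonglongrightarrow> f x"
      using cont x aC by (intro continuous_on_tendsto_compose[OF cont]) auto
    ultimately show ?thesis
      by (auto simp: tendsto_coordinatewise[of a] tendsto_coordinatewise[of "\<lambda>k. f (a k)"]
               intro: tendsto_diff)
  qed
  have "f x i = x i" for i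
  proof (cases "i < N")
    case True
    obtain a b where aC: "\<And>k. a k \<in> unit_cube N" and bC: "\<And>k. b k \<in> unit_cube N"
      and ab: "\<And>k j. \<bar>a k j - z k j\<bar> \<le> 1 / Suc k" "\<And>k j. \<bar>b k j - z k j\<bar> \<le> 1 / Suc k"
      and sign: "\<And>k. a k i \<le> f (a k) i" "\<And>k. f (b k) i \<le> b k i"
      using z[OF True] by metis
    have "0 \<le> f x i - x i"
      by (rule LIMSEQ_le_const[OF near_lim[of "a \<circ> \<sigma>"]]) (use aC ab sign in auto)
    moreover have "f x i - x i \<le> 0"
      by (rule LIMSEQ_le_const2[OF near_lim[of "b \<circ> \<sigma>"]]) (use bC ab sign in auto)
    ultimately show ?thesis by simp
  next
    case False
    moreover have "f x \<in> unit_cube N" using f x by auto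
    ultimately show ?thesis using x by (simp add: unit_cube_def)
  qed
  then have "f x = x" by (rule ext)
  with x show thesis by (rule that)
qed

text \<open>
  The simplex is a retract of the cube. The retraction \<open>\<rho>\<close> below scales a point down when its
  coordinates sum to more than \<open>1\<close>, and otherwise adds the missing mass to coordinate \<open>0\<close>. A fixed
  point of \<open>f \<circ> \<rho>\<close> is a value of \<open>f\<close>, so it lies in the simplex, where \<open>\<rho>\<close> is the identity.
\<close>

lemma brouwer_standard_simplex:
  fixes f :: "(nat \<Rightarrow> real) \<Rightarrow> nat \<Rightarrow> real"
  assumes f: "f \<in> standard_simplex p \<rightarrow> standard_simplex p"
    and cont: "continuous_on (standard_simplex p) f"
  obtains t where "t \<in> standard_simplex p" "f t = t"
proof -
  define \<rho> where "\<rho> x = (\<lambda>j. (x j + (if j = 0 then max 0 (1 - sum x {..p}) else 0)) / max 1 (sum x {..p}))"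
    for x :: "nat \<Rightarrow> real"
  have simplex_cube: "standard_simplex p \<subseteq> unit_cube (Suc p)"
    by (auto simp: standard_simplex_def unit_cube_def)
  have \<rho>_simplex: "\<rho> x \<in> standard_simplex p" if "x \<in> unit_cube (Suc p)" for x
  proof -
    have nonneg: "0 \<le> \<rho> x j" for j
      using that by (auto simp: \<rho>_def unit_cube_def)
    have "sum (\<rho> x) {..p} = (sum x {..p} + max 0 (1 - sum x {..p})) / max 1 (sum x {..p})"
      by (simp add: \<rho>_def sum.distrib flip: sum_divide_distrib)
    also have "\<dots> = 1" by (auto simp: max_def)
    finally have sum: "sum (\<rho> x) {..p} = 1" .
    moreover have zero: "\<rho> x j = 0" if "j > p" for j
      using that \<open>x \<in> _\<close> by (simp add: \<rho>_def unit_cube_def)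
    moreover have "\<rho> x j \<le> 1" for j
    proof (cases "j \<le> p")
      case True
      then show ?thesis using member_le_sum[of j "{..p}" "\<rho> x"] nonneg sum by simp
    qed (simp add: zero)
    ultimately show ?thesis using nonneg by (simp add: standard_simplex_def)
  qed
  have \<rho>_id: "\<rho> x = x" if "x \<in> standard_simplex p" for x
    using that by (auto simp: \<rho>_def standard_simplex_def)
  have coord: "continuous_on S (\<lambda>x. x j)" for S :: "(nat \<Rightarrow> real) set" and j
    by (rule continuous_on_subset[OF continuous_on_product_coordinates]) simp
  have "continuous_on (unit_cube (Suc p)) \<rho>"
  proof (rule continuous_on_coordinatewise_then_product)
    fix j :: nat
    have total: "continuous_on (unit_cube (Suc p)) (\<lambda>x. sum x {..p})"
      by (intro continuous_on_sum coord)
    have "continuous_on (unit_cube (Suc p)) (\<lambda>x. if j = 0 then max 0 (1 - sum x {..p}) else 0)"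
      by (cases "j = 0") (simp_all add: continuous_on_max continuous_on_diff total)
    then show "continuous_on (unit_cube (Suc p)) (\<lambda>x. \<rho> x j)"
      unfolding \<rho>_def
      by (intro continuous_on_divide continuous_on_add continuous_on_max coord total
          continuous_on_const ballI) auto
  qed
  then have "continuous_on (unit_cube (Suc p)) (f \<circ> \<rho>)"
    by (rule continuous_on_compose) (rule continuous_on_subset[OF cont], use \<rho>_simplex in auto)
  moreover have "f \<circ> \<rho> \<in> unit_cube (Suc p) \<rightarrow> unit_cube (Suc p)"
    using f \<rho>_simplex simplex_cube by fastforce
  ultimately obtain x where x: "x \<in> unit_cube (Suc p)" "f (\<rho> x) = x"
    by (metis brouwer_unit_cube comp_apply)
  then have "x \<in> standard_simplex p"
    using f \<rho>_simplex[OF x(1)] by (metis PiE)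
  then show thesis
    using x(2) \<rho>_id by (intro that) simp_all
qed

section \<open>Correspondences with open lower sections\<close>

text \<open>
  A variant of the Knaster-Kuratowski-Mazurkiewicz lemma for open covers. Normalising the distances
  to the complements of the \<open>U j\<close> gives a partition of unity subordinate to the cover, which is a map of
  the simplex to itself. At a fixed point \<open>t\<close> the weight \<open>t j\<close> is the value at \<open>t\<close> of a function that
  vanishes off \<open>U j\<close>, so \<open>0 < t j\<close> forces \<open>t \<in> U j\<close>.
\<close>

lemma standard_simplex_open_cover:
  assumes op: "\<And>j. j \<le> p \<Longrightarrow> openin (top_of_set (standard_simplex p)) (U j)"
    and cover: "standard_simplex p \<subseteq> (\<Union>j\<le>p. U j)"
  obtains t where "t \<in> standard_simplex p" "\<And>j. j \<le> p \<Longrightarrow> 0 < t j \<Longrightarrow> t \<in> U j"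
proof -
  let ?S = "standard_simplex p"
  \<comment> \<open>The distance to the empty set is \<open>0\<close> by convention, so a member equal to the whole simplex is treated apart.\<close>
  define d where "d j t = (if ?S \<subseteq> U j then 1 else infdist t (?S - U j))" for j t
  have cl: "closed (?S - U j)" if "j \<le> p" for j
  proof -
    have "closed ?S"
      using closedin_standard_simplex[of p] by (simp add: euclidean_product_topology)
    then show ?thesis
      using op[OF that] by (metis closedin_closed_trans closedin_diff closedin_topspace topspace_euclidean_subtopology)
  qed
  have d_pos: "0 < d j t \<longleftrightarrow> t \<in> U j" if "j \<le> p" "t \<in> ?S" for j t
    using that cl[of j] in_closed_iff_infdist_zero[of "?S - U j" t] infdist_nonneg[of t "?S - U j"]
    by (auto simp: d_def order_less_le)
  have d_nonneg: "0 \<le> d j t" for j t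
    by (simp add: d_def infdist_nonneg)
  define D where "D t = (\<Sum>j\<le>p. d j t)" for t
  have D_pos: "0 < D t" if t: "t \<in> ?S" for t
  proof -
    obtain j where "j \<le> p" "t \<in> U j" using cover t by blast
    then show ?thesis
      unfolding D_def using d_pos[of j t] t d_nonneg by (intro sum_pos2[of _ j]) simp_all
  qed
  define f where "f t = (\<lambda>j. if j \<le> p then d j t / D t else 0)" for t
  have f_simplex: "f t \<in> ?S" if "t \<in> ?S" for t
  proof -
    have "(\<Sum>j\<le>p. f t j) = (\<Sum>j\<le>p. d j t) / D t"
      by (simp add: f_def sum_divide_distrib)
    then have "(\<Sum>j\<le>p. f t j) = 1"
      using D_pos[OF that] by (simp add: D_def)
    moreover have "d j t \<le> D t" if "j \<le> p" for j
      unfolding D_def using d_nonneg that by (intro member_le_sum) auto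
    ultimately show ?thesis
      using D_pos[OF that] d_nonneg by (auto simp: standard_simplex_def f_def divide_le_eq)
  qed
  have d_cont: "continuous_on ?S (d j)" for j
    by (cases "?S \<subseteq> U j") (simp_all add: d_def[abs_def] continuous_on_infdist)
  have "continuous_on ?S (\<lambda>t. f t j)" for j
  proof (cases "j \<le> p")
    case True
    have "continuous_on ?S D"
      unfolding D_def by (intro continuous_on_sum d_cont)
    then show ?thesis
      using True D_pos unfolding f_def by (auto intro!: continuous_on_divide d_cont simp: less_le)
  qed (simp add: f_def)
  then have "continuous_on ?S f"
    by (rule continuous_on_coordinatewise_then_product)
  moreover have "f \<in> ?S \<rightarrow> ?S" using f_simplex by blast
  ultimately obtain t where t: "t \<in> ?S" "f t = t"
    by (metis brouwer_standard_simplex)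
  show thesis
  proof
    fix j assume "j \<le> p" "0 < t j"
    then have "0 < d j t / D t"
      using fun_cong[OF t(2), of j] by (simp add: f_def)
    then show "t \<in> U j"
      using d_pos[OF \<open>j \<le> p\<close> t(1)] D_pos[OF t(1)] by (simp add: zero_less_divide_iff)
  qed (fact t(1))
qed

text \<open>
  Browder's fixed point theorem, freed from vector spaces: the maps \<open>\<phi>\<close> stand for the convex
  combinations of the points \<open>w j\<close>, and the condition on them says that the values of \<open>T\<close> are convex.
  In this form the theorem applies to products of sets that lie in different spaces.

  By compactness finitely many lower sections, those of \<open>w 0, \<dots>, w p\<close>, cover \<open>K\<close>. Their preimages
  under \<open>\<phi>\<close> cover the simplex, so there is a \<open>t\<close> such that \<open>w j \<in> T (\<phi> t)\<close> whenever \<open>0 < t j\<close>.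
  Then the combination \<open>\<phi> t\<close> of these points belongs to \<open>T (\<phi> t)\<close> as well.
\<close>

theorem fixed_point_of_open_lower_sections:
  assumes "compact_space K" and nonempty: "topspace K \<noteq> {}"
    and T: "\<And>x. x \<in> topspace K \<Longrightarrow> T x \<noteq> {} \<and> T x \<subseteq> topspace K"
    and sections: "open_lower_sections K (topspace K) T"
    and simplices: "\<And>p w. w \<in> {..p} \<rightarrow> topspace K \<Longrightarrow>
      \<exists>\<phi>. continuous_map (top_of_set (standard_simplex p)) K \<phi> \<and>
        (\<forall>t\<in>standard_simplex p. \<forall>x\<in>topspace K. (\<forall>j\<le>p. 0 < t j \<longrightarrow> w j \<in> T x) \<longrightarrow> \<phi> t \<in> T x)"
  obtains x where "x \<in> topspace K" "x \<in> T x"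
proof -
  define L where "L y = {x \<in> topspace K. y \<in> T x}" for y
  have L_open: "openin K (L y)" if "y \<in> topspace K" for y
    using sections that by (simp add: L_def open_lower_sections_def)
  have "topspace K \<subseteq> \<Union>(L ` topspace K)"
    using T by (fastforce simp: L_def)
  then obtain \<F> where "finite \<F>" "\<F> \<subseteq> L ` topspace K" and \<F>: "topspace K \<subseteq> \<Union>\<F>"
    using \<open>compact_space K\<close> L_open unfolding compact_space_alt by (metis (no_types, lifting) image_iff)
  then obtain Y where Y: "finite Y" "Y \<subseteq> topspace K" "topspace K \<subseteq> (\<Union>y\<in>Y. L y)"
    by (metis finite_subset_image)
  then have "Y \<noteq> {}" using nonempty by auto
  obtain m w where w: "Y = w ` {i. i < (m :: nat)}"
    using finite_imp_nat_seg_image_inj_on[OF \<open>finite Y\<close>] by blast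
  with \<open>Y \<noteq> {}\<close> obtain p where "m = Suc p"
    by (cases m) auto
  with w have w: "Y = w ` {..p}"
    by (simp add: lessThan_Suc_atMost flip: lessThan_def)
  then have wK: "w \<in> {..p} \<rightarrow> topspace K" using Y by auto
  from simplices[OF wK] obtain \<phi> where cont: "continuous_map (top_of_set (standard_simplex p)) K \<phi>"
    and \<phi>: "\<And>t x. \<lbrakk>t \<in> standard_simplex p; x \<in> topspace K; \<And>j. \<lbrakk>j \<le> p; 0 < t j\<rbrakk> \<Longrightarrow> w j \<in> T x\<rbrakk> \<Longrightarrow> \<phi> t \<in> T x"
    by blast
  have \<phi>K: "\<phi> t \<in> topspace K" if "t \<in> standard_simplex p" for t
    using continuous_map_image_subset_topspace[OF cont] that by auto
  obtain t where t: "t \<in> standard_simplex p"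
    and active: "\<And>j. \<lbrakk>j \<le> p; 0 < t j\<rbrakk> \<Longrightarrow> t \<in> {s \<in> standard_simplex p. \<phi> s \<in> L (w j)}"
  proof (rule standard_simplex_open_cover[of p "\<lambda>j. {s \<in> standard_simplex p. \<phi> s \<in> L (w j)}"])
    show "openin (top_of_set (standard_simplex p)) {s \<in> standard_simplex p. \<phi> s \<in> L (w j)}" if "j \<le> p" for j
      using openin_continuous_map_preimage[OF cont L_open[of "w j"]] wK that by auto
    show "standard_simplex p \<subseteq> (\<Union>j\<le>p. {s \<in> standard_simplex p. \<phi> s \<in> L (w j)})"
      using \<phi>K Y(3) unfolding w by blast
  qed blast
  have "\<phi> t \<in> T (\<phi> t)"
    using active by (intro \<phi> t \<phi>K) (simp add: L_def)
  with \<phi>K[OF t] show thesis by (rule that)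
qed

section \<open>Convex combinations of profiles\<close>

lemma continuous_map_linear_combination:
  fixes a :: "nat \<Rightarrow> 'e::real_vector"
  assumes E: "topological_vector_space_on E" and "finite J" "a ` J \<subseteq> topspace E"
  shows "continuous_map (top_of_set S) E (\<lambda>t :: nat \<Rightarrow> real. \<Sum>j\<in>J. t j *\<^sub>R a j)"
  using assms(2,3)
proof (induction J rule: finite_induct)
  case empty
  have "0 \<in> topspace E"
    using E by (auto simp: topological_vector_space_on_def subspace_0)
  then show ?case by simp
next
  case (insert k J)
  have "continuous_map (top_of_set S) euclideanreal (\<lambda>t. t k)"
    by (simp add: continuous_on_subset[OF continuous_on_product_coordinates])
  then have "continuous_map (top_of_set S) (prod_topology euclideanreal E) (\<lambda>t. (t k, a k))"
    using insert by (simp add: continuous_map_paired)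
  then have "continuous_map (top_of_set S) E ((\<lambda>(c, x). c *\<^sub>R x) \<circ> (\<lambda>t. (t k, a k)))"
    by (rule continuous_map_compose) (use E in \<open>simp add: topological_vector_space_on_def\<close>)
  then have "continuous_map (top_of_set S) (prod_topology E E) (\<lambda>t. (t k *\<^sub>R a k, \<Sum>j\<in>J. t j *\<^sub>R a j))"
    using insert by (simp add: continuous_map_paired o_def)
  then have "continuous_map (top_of_set S) E
      ((\<lambda>(x, y). x + y) \<circ> (\<lambda>t. (t k *\<^sub>R a k, \<Sum>j\<in>J. t j *\<^sub>R a j)))"
    by (rule continuous_map_compose) (use E in \<open>simp add: topological_vector_space_on_def\<close>)
  then show ?case
    using insert by (simp add: o_def)
qed

text \<open>
  Membership in \<open>C\<close> is asked only at positive weight because the open cover lemma gives information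
  about just those points.
\<close>

lemma convex_barycentric_combination:
  fixes a :: "nat \<Rightarrow> 'e::real_vector"
  assumes C: "convex C" and t: "t \<in> standard_simplex p"
    and a: "\<And>j. \<lbrakk>j \<le> p; 0 < t j\<rbrakk> \<Longrightarrow> a j \<in> C"
  shows "(\<Sum>j\<le>p. t j *\<^sub>R a j) \<in> C"
proof -
  let ?J = "{j. j \<le> p \<and> 0 < t j}"
  have t': "0 \<le> t j" "sum t {..p} = 1" for j
    using t by (auto simp: standard_simplex_def)
  have drop: "j \<in> {..p} - ?J \<Longrightarrow> t j = 0" for j
    using t'(1)[of j] by auto
  have "sum t ?J = 1"
    unfolding t'(2)[symmetric] by (rule sum.mono_neutral_left) (use drop in auto)
  then have "(\<Sum>j\<in>?J. t j *\<^sub>R a j) \<in> C"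
    using a t' by (intro convex_sum C) auto
  also have "(\<Sum>j\<in>?J. t j *\<^sub>R a j) = (\<Sum>j\<le>p. t j *\<^sub>R a j)"
    by (rule sum.mono_neutral_left) (use drop in auto)
  finally show ?thesis .
qed

lemma continuous_map_profile_combination:
  fixes E :: "nat \<Rightarrow> 'e::real_vector topology"
  assumes E: "\<And>i. i \<in> I \<Longrightarrow> topological_vector_space_on (E i) \<and> convex (X i) \<and> X i \<subseteq> topspace (E i)"
    and w: "\<And>j. j \<le> p \<Longrightarrow> w j \<in> (\<Pi>\<^sub>E i\<in>I. X i)"
  shows "continuous_map (top_of_set (standard_simplex p)) (product_topology (\<lambda>i. subtopology (E i) (X i)) I)
           (\<lambda>t. \<lambda>i\<in>I. \<Sum>j\<le>p. t j *\<^sub>R w j i)"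
proof -
  have "continuous_map (top_of_set (standard_simplex p)) (subtopology (E i) (X i)) (\<lambda>t. \<Sum>j\<le>p. t j *\<^sub>R w j i)"
    if i: "i \<in> I" for i
  proof (rule continuous_map_into_subtopology)
    show "continuous_map (top_of_set (standard_simplex p)) (E i) (\<lambda>t. \<Sum>j\<le>p. t j *\<^sub>R w j i)"
      using E[OF i] w i by (intro continuous_map_linear_combination) auto
    show "(\<lambda>t. \<Sum>j\<le>p. t j *\<^sub>R w j i) \<in> topspace (top_of_set (standard_simplex p)) \<rightarrow> X i"
      using E[OF i] w i by (auto intro!: convex_barycentric_combination)
  qed
  then show ?thesis
    by (auto simp: continuous_map_componentwise)
qed

lemma continuous_map_except:
  "continuous_map (product_topology (\<lambda>j. subtopology (E j) (X j)) {1..n})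
     (profiles_except_topology n E X i) (except n i)"
  unfolding profiles_except_topology_def except_def
  by (auto simp: continuous_map_componentwise intro: continuous_map_product_projection)

lemma profile_eq_except_upd:
  assumes "x \<in> profiles n X" "i \<in> {1..n}"
  shows "(except n i x)(i := x i) = x"
  using assms by (auto simp: fun_eq_iff except_def profiles_def restrict_def PiE_iff extensional_def)

section \<open>Existence of equilibrium\<close>

theorem theorem3:
  fixes n :: nat
    and E :: "nat \<Rightarrow> 'e::real_vector topology"
    and X :: "nat \<Rightarrow> 'e set"
    and A F :: "nat \<Rightarrow> (nat \<Rightarrow> 'e) \<Rightarrow> 'e set"
    and P :: "nat \<Rightarrow> (nat \<Rightarrow> 'e) \<times> (nat \<Rightarrow> 'e) \<Rightarrow> 'e set"
  assumes economy: "generalized_abstract_economy n X A F P"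
    and a: "\<And>i. i \<in> {1..n} \<Longrightarrow>
        locally_convex_space_on (E i) \<and> Hausdorff_space (E i) \<and>
        X i \<noteq> {} \<and> convex (X i) \<and> compactin (E i) (X i)"
    and b: "\<And>i. i \<in> {1..n} \<Longrightarrow>
        (\<forall>u\<in>profiles_except n X i.
           A i u \<noteq> {} \<and> convex (A i u) \<and> F i u \<noteq> {} \<and> convex (F i u)) \<and>
        open_lower_sections (profiles_except_topology n E X i) (X i) (A i) \<and>
        open_lower_sections (profiles_except_topology n E X i) (X i) (F i)"
    and c: "\<And>i u v. \<lbrakk>i \<in> {1..n}; u \<in> profiles_except n X i; v \<in> profiles_except n X i\<rbrakk> \<Longrightarrow>
        {(xi, yi) \<in> X i \<times> X i. A i u \<inter> P i (u(i := xi), v(i := yi)) = {}} \<inter> (A i u \<times> F i v) \<noteq> {}"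
    and d: "\<And>i u v. \<lbrakk>i \<in> {1..n}; u \<in> profiles_except n X i; v \<in> profiles_except n X i\<rbrakk> \<Longrightarrow>
        convex {(xi, yi) \<in> X i \<times> X i. A i u \<inter> P i (u(i := xi), v(i := yi)) = {}}"
    and e: "\<And>i xi yi. \<lbrakk>i \<in> {1..n}; xi \<in> X i; yi \<in> X i\<rbrakk> \<Longrightarrow>
        openin (prod_topology (profiles_except_topology n E X i) (profiles_except_topology n E X i))
          {(u, v) \<in> profiles_except n X i \<times> profiles_except n X i.
             A i u \<inter> P i (u(i := xi), v(i := yi)) = {}}"
  shows "\<exists>x\<in>profiles n X. \<exists>y\<in>profiles n X. \<forall>i\<in>{1..n}.
      x i \<in> A i (except n i x) \<and> y i \<in> F i (except n i y) \<and>
      A i (except n i x) \<inter> P i (x, y) = {}"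
proof -
  define PX where "PX = product_topology (\<lambda>j. subtopology (E j) (X j)) {1..n}"
  let ?K = "prod_topology PX PX"
  have X: "topological_vector_space_on (E i) \<and> convex (X i) \<and> X i \<subseteq> topspace (E i)"
    if "i \<in> {1..n}" for i
    using a[OF that] by (auto simp: locally_convex_space_on_def compactin_subset_topspace)
  have top_X: "topspace (subtopology (E i) (X i)) = X i" if "i \<in> {1..n}" for i
    using X[OF that] by (simp add: inf_absorb2)
  have top_PX: "topspace PX = profiles n X"
    unfolding PX_def profiles_def topspace_product_topology by (intro PiE_cong) (simp only: o_apply top_X)
  have top_except: "topspace (profiles_except_topology n E X i) = profiles_except n X i" for i
    unfolding profiles_except_topology_def profiles_except_def topspace_product_topology
    by (intro PiE_cong) (metis DiffD1 o_apply top_X)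
  have except: "except n i x \<in> profiles_except n X i" if "x \<in> profiles n X" for i x
    using that by (auto simp: except_def profiles_def profiles_except_def)
  have cont_except: "continuous_map PX (profiles_except_topology n E X i) (except n i)" for i
    unfolding PX_def by (rule continuous_map_except)
  define R where "R i u v =
      {(xi, yi) \<in> X i \<times> X i. A i u \<inter> P i (u(i := xi), v(i := yi)) = {}} \<inter> (A i u \<times> F i v)" for i u v
  define T where "T = (\<lambda>(x, y). {(x', y'). x' \<in> profiles n X \<and> y' \<in> profiles n X \<and>
      (\<forall>i\<in>{1..n}. (x' i, y' i) \<in> R i (except n i x) (except n i y))})"
  have R_sub: "fst q \<in> X i \<and> snd q \<in> X i" if "q \<in> R i u v" for i u v q
    using that by (auto simp: R_def)
  have R_convex: "convex (R i u v)"
    if "i \<in> {1..n}" "u \<in> profiles_except n X i" "v \<in> profiles_except n X i" for i u v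
    unfolding R_def using b[OF that(1)] that by (intro convex_Int d convex_Times) auto
  obtain z where "z \<in> topspace ?K" "z \<in> T z"
  proof (rule fixed_point_of_open_lower_sections[of ?K T])
    show "compact_space ?K"
      using a by (auto simp: PX_def compact_space_prod_topology compact_space_product_topology compact_space_subtopology)
    show "topspace ?K \<noteq> {}"
      using a by (simp add: top_PX profiles_def PiE_eq_empty_iff)
    show "T z \<noteq> {} \<and> T z \<subseteq> topspace ?K" if zK: "z \<in> topspace ?K" for z
    proof
      obtain x y where z: "z = (x, y)" and xy: "x \<in> profiles n X" "y \<in> profiles n X"
        using zK by (auto simp: top_PX)
      have "\<exists>q. q \<in> R i (except n i x) (except n i y)" if "i \<in> {1..n}" for i
        using c[OF that except[OF xy(1)] except[OF xy(2)]] unfolding R_def by blast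
      then obtain q where q: "\<And>i. i \<in> {1..n} \<Longrightarrow> q i \<in> R i (except n i x) (except n i y)"
        by metis
      then have "((\<lambda>i\<in>{1..n}. fst (q i)), (\<lambda>i\<in>{1..n}. snd (q i))) \<in> T z"
        using R_sub[OF q] by (simp add: T_def z profiles_def)
      then show "T z \<noteq> {}" by blast
      show "T z \<subseteq> topspace ?K" by (auto simp: T_def top_PX z)
    qed
    show "open_lower_sections ?K (topspace ?K) T"
      unfolding open_lower_sections_def
    proof
      fix w assume "w \<in> topspace ?K"
      then obtain a' b' where w: "w = (a', b')" and ab: "a' \<in> profiles n X" "b' \<in> profiles n X"
        by (auto simp: top_PX)
      \<comment> \<open>The lower section of \<open>T\<close> at \<open>w\<close> is the intersection of the \<open>n\<close> sets \<open>B i\<close>, one for each player.\<close>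
      define B where "B i = {z \<in> topspace ?K. (a' i, b' i) \<in> R i (except n i (fst z)) (except n i (snd z))}" for i
      have "openin ?K (B i)" if i: "i \<in> {1..n}" for i
      proof -
        let ?M = "profiles_except_topology n E X i"
        have abi: "a' i \<in> X i" "b' i \<in> X i"
          using ab i by (auto simp: profiles_def)
        \<comment> \<open>Hypothesis \<open>e\<close> and the lower sections of \<open>A i\<close> and \<open>F i\<close> make \<open>G\<close> open, and \<open>B i\<close> is its preimage.\<close>
        define G where "G = {(u, v) \<in> profiles_except n X i \<times> profiles_except n X i.
               A i u \<inter> P i (u(i := a' i), v(i := b' i)) = {}} \<inter>
            ({u \<in> topspace ?M. a' i \<in> A i u} \<times> {v \<in> topspace ?M. b' i \<in> F i v})"
        have "openin (prod_topology ?M ?M) G"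
          unfolding G_def using b[OF i] abi
          by (intro openin_Int e i) (simp_all add: openin_prod_Times_iff open_lower_sections_def)
        moreover have "continuous_map ?K (prod_topology ?M ?M) (\<lambda>z. (except n i (fst z), except n i (snd z)))"
          unfolding continuous_map_paired
          by (intro conjI continuous_map_compose[OF continuous_map_fst cont_except, unfolded o_def]
              continuous_map_compose[OF continuous_map_snd cont_except, unfolded o_def])
        ultimately have "openin ?K {z \<in> topspace ?K. (except n i (fst z), except n i (snd z)) \<in> G}"
          by (intro openin_continuous_map_preimage)
        also have "{z \<in> topspace ?K. (except n i (fst z), except n i (snd z)) \<in> G} = B i"
          using abi except by (auto simp: B_def G_def R_def top_PX top_except)
        finally show ?thesis .
      qed
      then have "openin ?K ((\<Inter>i\<in>{1..n}. B i) \<inter> topspace ?K)"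
        by (intro openin_INT) auto
      also have "(\<Inter>i\<in>{1..n}. B i) \<inter> topspace ?K = {z \<in> topspace ?K. w \<in> T z}"
        using ab by (auto simp: B_def T_def w)
      finally show "openin ?K {z \<in> topspace ?K. w \<in> T z}" .
    qed
    fix p and w :: "nat \<Rightarrow> (nat \<Rightarrow> 'e) \<times> (nat \<Rightarrow> 'e)"
    assume "w \<in> {..p} \<rightarrow> topspace ?K"
    then have w: "fst (w j) \<in> profiles n X" "snd (w j) \<in> profiles n X" if "j \<le> p" for j
      using that by (fastforce simp: top_PX mem_Times_iff)+
    let ?f = "\<lambda>t. \<lambda>i\<in>{1..n}. \<Sum>j\<le>p. t j *\<^sub>R fst (w j) i"
    let ?g = "\<lambda>t. \<lambda>i\<in>{1..n}. \<Sum>j\<le>p. t j *\<^sub>R snd (w j) i"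
    have cont: "continuous_map (top_of_set (standard_simplex p)) PX ?f"
      "continuous_map (top_of_set (standard_simplex p)) PX ?g"
      unfolding PX_def using w[unfolded profiles_def]
      by (intro continuous_map_profile_combination X; simp)+
    have "(?f t, ?g t) \<in> T z"
      if t: "t \<in> standard_simplex p" and "z \<in> topspace ?K"
        and wT: "\<forall>j\<le>p. 0 < t j \<longrightarrow> w j \<in> T z" for t z
    proof -
      obtain x y where z: "z = (x, y)" and xy: "x \<in> profiles n X" "y \<in> profiles n X"
        using \<open>z \<in> topspace ?K\<close> by (auto simp: top_PX)
      have "?f t \<in> profiles n X" "?g t \<in> profiles n X"
        using cont[THEN continuous_map_image_subset_topspace] t by (auto simp: top_PX)
      moreover have "(?f t i, ?g t i) \<in> R i (except n i x) (except n i y)" if i: "i \<in> {1..n}" for i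
      proof -
        \<comment> \<open>Hypothesis \<open>d\<close> is convexity in the pair, so the same weights must combine both components.\<close>
        have "(\<Sum>j\<le>p. t j *\<^sub>R (fst (w j) i, snd (w j) i)) \<in> R i (except n i x) (except n i y)"
        proof (rule convex_barycentric_combination[OF R_convex[OF i except[OF xy(1)] except[OF xy(2)]] t])
          fix j assume "j \<le> p" "0 < t j"
          with wT have "w j \<in> T z" by blast
          then show "(fst (w j) i, snd (w j) i) \<in> R i (except n i x) (except n i y)"
            using i by (auto simp: T_def z)
        qed
        also have "(\<Sum>j\<le>p. t j *\<^sub>R (fst (w j) i, snd (w j) i)) = (?f t i, ?g t i)"
          using i by (simp add: prod_eq_iff fst_sum snd_sum)
        finally show ?thesis .
      qed
      ultimately show ?thesis by (simp add: T_def z)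
    qed
    with cont show "\<exists>\<phi>. continuous_map (top_of_set (standard_simplex p)) ?K \<phi> \<and>
        (\<forall>t\<in>standard_simplex p. \<forall>x\<in>topspace ?K. (\<forall>j\<le>p. 0 < t j \<longrightarrow> w j \<in> T x) \<longrightarrow> \<phi> t \<in> T x)"
      by (intro exI[of _ "\<lambda>t. (?f t, ?g t)"]) (simp add: continuous_map_paired)
  qed blast
  then obtain x y where xy: "x \<in> profiles n X" "y \<in> profiles n X"
    and fixed: "\<And>i. i \<in> {1..n} \<Longrightarrow> (x i, y i) \<in> R i (except n i x) (except n i y)"
    by (auto simp: T_def)
  have "x i \<in> A i (except n i x) \<and> y i \<in> F i (except n i y) \<and> A i (except n i x) \<inter> P i (x, y) = {}"
    if i: "i \<in> {1..n}" for i
    using fixed[OF i] profile_eq_except_upd[OF xy(1) i] profile_eq_except_upd[OF xy(2) i]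
    by (simp add: R_def)
  with xy show ?thesis by blast
qed

end
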